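(* Let $n \ge 3$. Consider $n$-dimensional simplices in Euclidean space $\mathbb{E}^n$ with vertices labeled $1, \dots, n+1$, and let $l_{ij}$ ($1 \le i < j \le n+1$) denote the length of the edge joining vertices $i$ and $j$. Let $U \subset \mathbb{R}^{n(n+1)/2}$ be the (nonempty, open) set of edge-length vectors $(l_{ij})_{i<j}$ realized by nondegenerate $n$-simplices. For each $(n-1)$-element subset $S \subset \{1,\dots,n+1\}$, let $V_S : U \to \mathbb{R}$ be the function assigning to an edge-length vector the $(n-2)$-dimensional volume of the $(n-2)$-dimensional face of the simplex spanned by the vertices in $S$ (this is well defined since a simplex is determined up to congruence by its edge lengths). Then the $\binom{n+1}{n-1} = n(n+1)/2$ functions $V_S$ are algebraically independent over $\mathbb{C}$: there is no nonzero polynomial $P$ with complex coefficients in $n(n+1)/2$ variables such that $P\big((V_S)_S\big)$ vanishes identically on $U$.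
   Context: An $n$-simplex in $\mathbb{E}^n$ is determined up to congruence by its $n(n+1)/2$ edge lengths; each $(n-2)$-dimensional face corresponds to a choice of $n-1$ of the $n+1$ vertices. *)

theory Defs
  imports "HOL-Analysis.Analysis"
begin

definition det_nat :: "nat \<Rightarrow> (nat \<Rightarrow> nat \<Rightarrow> real) \<Rightarrow> real" where
  "det_nat k A = (\<Sum>\<sigma> | \<sigma> permutes {..<k}. of_int (sign \<sigma>) * (\<Prod>a<k. A a (\<sigma> a)))"

text \<open>The (card S - 1)-dimensional volume of the simplex spanned by the points p i, i in S:
  sqrt of the Gram determinant of the edge vectors from one vertex, divided by k!.\<close>
definition face_volume :: "(nat \<Rightarrow> 'a::euclidean_space) \<Rightarrow> nat set \<Rightarrow> real" where
  "face_volume p S =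
    (let xs = sorted_list_of_set S;
         vs = map (\<lambda>i. p i - p (hd xs)) (tl xs);
         k = length vs
     in sqrt (det_nat k (\<lambda>a b. inner (vs ! a) (vs ! b))) / fact k)"

definition nondegenerate_simplex :: "(nat \<Rightarrow> real ^ 'n) \<Rightarrow> bool" where
  "nondegenerate_simplex p \<longleftrightarrow>
     inj_on p {1..CARD('n)+1} \<and> \<not> affine_dependent (p ` {1..CARD('n)+1})"

definition edge_lengths :: "(nat \<Rightarrow> real ^ 'n) \<Rightarrow> (nat \<times> nat \<Rightarrow> real)" where
  "edge_lengths p = (\<lambda>(i,j). if 1 \<le> i \<and> i < j \<and> j \<le> CARD('n)+1 then dist (p i) (p j) else 0)"

definition realizable_lengths :: "('n::finite) itself \<Rightarrow> (nat \<times> nat \<Rightarrow> real) set" where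
  "realizable_lengths _ = {l. \<exists>p::nat \<Rightarrow> real ^ 'n. nondegenerate_simplex p \<and> edge_lengths p = l}"

definition face_vol_fun :: "('n::finite) itself \<Rightarrow> nat set \<Rightarrow> (nat \<times> nat \<Rightarrow> real) \<Rightarrow> real" where
  "face_vol_fun _ S l = face_volume (SOME p::nat \<Rightarrow> real ^ 'n. nondegenerate_simplex p \<and> edge_lengths p = l) S"

definition faces :: "nat \<Rightarrow> nat set set" where
  "faces n = {S. S \<subseteq> {1..n+1} \<and> card S = n - 1}"

end

theory Submission
  imports Defs "HOL-Computational_Algebra.Polynomial" "Jordan_Normal_Form.Determinant"
begin

text \<open>Deform the regular simplex by a linear family of vertex displacements chosen so that the
  squared edge lengths change to first order by a prescribed amount. At the regular simplex the
  derivative of the volume of a face is, up to a nonzero constant, the sum of the derivatives of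
  the squared lengths of its edges. Indexing an (n-2)-face by the complementary pair of vertices,
  this is the adjacency matrix of the Kneser graph of pairs in an (n+1)-set, which is invertible
  for n at least 3. Hence the face volumes can be prescribed arbitrarily to first order, so by
  Sussmann's open mapping theorem they fill a box, and a polynomial vanishing on a box is zero.\<close>

no_notation scalar_prod (infix "\<bullet>" 70)
no_notation vec_index (infixl "$" 100)

section \<open>Polynomials vanishing on a product of infinite sets\<close>

text \<open>Induction on the set of variables. With all variables but \<open>s\<close> frozen, the
  sum is a univariate polynomial with infinitely many roots, so each of its coefficients vanishes,
  and such a coefficient is a sum of the same shape over \<open>F\<close>. Exponents are total
  functions, hence the assumption that members of \<open>E\<close> already differ on
  \<open>F\<close>.\<close>

lemma multipoly_zero:
  fixes c :: "('a \<Rightarrow> nat) \<Rightarrow> complex"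
  assumes "finite F" "finite E"
    and "\<And>e e'. e \<in> E \<Longrightarrow> e' \<in> E \<Longrightarrow> (\<forall>S\<in>F. e S = e' S) \<Longrightarrow> e = e'"
    and "\<And>S. S \<in> F \<Longrightarrow> infinite (A S)"
    and "\<And>z. (\<And>S. S \<in> F \<Longrightarrow> z S \<in> A S) \<Longrightarrow>
           (\<Sum>e\<in>E. c e * (\<Prod>S\<in>F. complex_of_real (z S) ^ e S)) = 0"
  shows "\<forall>e\<in>E. c e = 0"
  using assms
proof (induction F arbitrary: E rule: finite_induct)
  case empty
  show ?case
  proof
    fix e assume "e \<in> E"
    then have "E = {e}" using empty.prems(2) by blast
    then show "c e = 0" using empty.prems(4) by simp
  qed
next
  case (insert s F)
  show ?case
  proof
    fix e0 assume e0: "e0 \<in> E"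
    \<comment> \<open>These exponents contribute to the coefficient of the power \<open>e0 s\<close>
      of the variable \<open>s\<close>; among them, \<open>F\<close> alone separates.\<close>
    define E' where "E' = {e \<in> E. e s = e0 s}"
    have "\<forall>e\<in>E'. c e = 0"
    proof (rule insert.IH)
      show "finite E'" using insert.prems(1) by (simp add: E'_def)
      show "e = e'" if "e \<in> E'" "e' \<in> E'" "\<forall>S\<in>F. e S = e' S" for e e'
        using that insert.prems(2)[of e e'] by (auto simp: E'_def)
      show "infinite (A S)" if "S \<in> F" for S using insert.prems(3) that by blast
      fix z :: "'a \<Rightarrow> real" assume z: "\<And>S. S \<in> F \<Longrightarrow> z S \<in> A S"
      define a where "a e = c e * (\<Prod>S\<in>F. complex_of_real (z S) ^ e S)" for e
      define P where "P = (\<Sum>e\<in>E. monom (a e) (e s))"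
      have "poly P (complex_of_real t) = 0" if t: "t \<in> A s" for t
      proof -
        have "(\<Sum>e\<in>E. c e * (\<Prod>S\<in>insert s F. complex_of_real ((z(s:=t)) S) ^ e S)) = 0"
          using t z insert.hyps by (intro insert.prems(4)) auto
        moreover have "(\<Prod>S\<in>F. complex_of_real ((z(s:=t)) S) ^ e S) =
            (\<Prod>S\<in>F. complex_of_real (z S) ^ e S)" for e
          using insert.hyps by (intro prod.cong) auto
        ultimately show ?thesis
          using insert.hyps by (simp add: P_def poly_sum poly_monom a_def mult_ac)
      qed
      then have "of_real ` A s \<subseteq> {t. poly P t = 0}" by auto
      moreover have "inj_on complex_of_real (A s)" by (intro inj_onI) (simp only: of_real_eq_iff)
      then have "infinite (complex_of_real ` A s)"
        using insert.prems(3)[of s] finite_imageD by blast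
      ultimately have "infinite {t. poly P t = 0}" by (rule infinite_super)
      then have "P = 0" using poly_roots_finite[of P] by (cases "P = 0") auto
      then have "coeff P (e0 s) = 0" by simp
      then show "(\<Sum>e\<in>E'. c e * (\<Prod>S\<in>F. complex_of_real (z S) ^ e S)) = 0"
        using insert.prems(1) by (simp add: P_def coeff_sum E'_def a_def sum.inter_filter)
    qed
    then show "c e0 = 0" using e0 by (simp add: E'_def)
  qed
qed

subsection \<open>Determinants near the Gram matrix of a regular simplex\<close>

lemma det_nat_conv_det: "det_nat k A = Determinant.det (Matrix.mat k k (\<lambda>(i, j). A i j))"
  unfolding det_nat_def Determinant.det_def
  by (auto intro!: sum.cong prod.cong simp: lessThan_atLeast0 permutes_in_image)

lemma det_nat_mult:
  "det_nat k A * det_nat k B = det_nat k (\<lambda>i j. \<Sum>l<k. A i l * B l j)"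
proof -
  have "Matrix.mat k k (\<lambda>(i, j). A i j) * Matrix.mat k k (\<lambda>(i, j). B i j)
      = Matrix.mat k k (\<lambda>(i, j). \<Sum>l<k. A i l * B l j)"
    by (intro eq_matI) (auto simp: scalar_prod_def lessThan_atLeast0)
  then show ?thesis
    unfolding det_nat_conv_det by (subst det_mult[symmetric, of _ k]) auto
qed

lemma det_nat_cong: "(\<And>i j. i < k \<Longrightarrow> j < k \<Longrightarrow> A i j = B i j) \<Longrightarrow> det_nat k A = det_nat k B"
  unfolding det_nat_conv_det by (intro arg_cong[where f = "Determinant.det"] cong_mat) auto

text \<open>A permutation that fixes every index except possibly \<open>a\<close> fixes
  \<open>a\<close> too, so only the identity survives in the Leibniz sum.\<close>

lemma det_nat_almost_diagonal:
  assumes "\<And>i j. i < k \<Longrightarrow> j < k \<Longrightarrow> i \<noteq> a \<Longrightarrow> i \<noteq> j \<Longrightarrow> A i j = 0"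
  shows "det_nat k A = (\<Prod>i<k. A i i)"
proof -
  have "(\<Prod>i<k. A i (\<sigma> i)) = 0" if s: "\<sigma> permutes {..<k}" "\<sigma> \<noteq> id" for \<sigma>
  proof -
    have "\<exists>i<k. i \<noteq> a \<and> \<sigma> i \<noteq> i"
    proof (rule ccontr)
      assume "\<not> ?thesis"
      then have *: "\<sigma> i = i" if "i \<noteq> a" for i
        using that permutes_not_in[OF s(1), of i] by (cases "i < k") auto
      have "\<sigma> a = a"
      proof (rule ccontr)
        assume "\<sigma> a \<noteq> a"
        then show False using *[of "\<sigma> a"] injD[OF permutes_inj[OF s(1)], of "\<sigma> a" a] by simp
      qed
      then have "\<sigma> i = i" for i using *[of i] by (cases "i = a") simp_all
      then show False using s(2) by (simp add: fun_eq_iff)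
    qed
    then obtain i where i: "i < k" "i \<noteq> a" "\<sigma> i \<noteq> i" by blast
    then have "\<sigma> i < k" using permutes_in_image[OF s(1), of i] by simp
    then show ?thesis using i assms[of i "\<sigma> i"] by (auto intro!: prod_zero)
  qed
  then have "det_nat k A = (\<Sum>\<sigma>\<in>{id}. of_int (sign \<sigma>) * (\<Prod>i<k. A i (\<sigma> i)))"
    unfolding det_nat_def
    by (intro sum.mono_neutral_right) (auto simp: finite_permutations permutes_id)
  then show ?thesis by (simp add: sign_id)
qed

text \<open>The Gram matrix of the edge vectors from one vertex of a regular simplex with squared
  edge length 2.\<close>

definition regular_gram :: "nat \<Rightarrow> nat \<Rightarrow> real" where
  "regular_gram i j = (if i = j then 2 else 1)"

text \<open>The linear form in \<open>r\<close> has the cofactors of row \<open>a\<close> as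
  coefficients. The Gram matrix is I + J with J all ones, its inverse is I - J/(k+1), and the
  cofactors are proportional to row \<open>a\<close> of that inverse.\<close>

lemma det_nat_regular_gram_row:
  "\<exists>C\<noteq>0. \<forall>a<k. \<forall>r. det_nat k (\<lambda>i. if i = a then r else regular_gram i)
      = C * (real (k + 1) * r a - (\<Sum>j<k. r j))"
proof -
  \<comment> \<open>N is (k + 1) times the inverse of the Gram matrix; multiplying by it makes every row but
    row a diagonal.\<close>
  define N where "N i j = (if i = j then real k else -1)" for i j :: nat
  have rowN: "(\<Sum>l<k. r l * N l j) = real (k + 1) * r j - (\<Sum>l<k. r l)" if "j < k" for r j
  proof -
    have "(\<Sum>l<k. r l * N l j) = (\<Sum>l<k. (if l = j then real (k+1) * r j else 0) - r l)"
      by (intro sum.cong) (auto simp: N_def algebra_simps)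
    then show ?thesis using that by (simp add: sum_subtractf)
  qed
  have sumG: "(\<Sum>j<k. regular_gram i j) = real (k + 1)" if "i < k" for i
  proof -
    have "(\<Sum>j<k. regular_gram i j) = (\<Sum>j<k. (if i = j then 1 else 0) + 1)"
      by (intro sum.cong) (auto simp: regular_gram_def)
    then show ?thesis using that by (simp add: sum.distrib)
  qed
  have key: "det_nat k (\<lambda>i. if i = a then r else regular_gram i) * det_nat k N
      = real (k + 1) ^ (k - 1) * (real (k + 1) * r a - (\<Sum>j<k. r j))" if a: "a < k" for a r
  proof -
    have "det_nat k (\<lambda>i. if i = a then r else regular_gram i) * det_nat k N =
       det_nat k (\<lambda>i j. if i = a then real (k + 1) * r j - (\<Sum>l<k. r l)
          else if i = j then real (k+1) else 0)"
      unfolding det_nat_mult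
      by (intro det_nat_cong) (simp add: rowN sumG, simp add: regular_gram_def)
    also have "\<dots> = (\<Prod>i<k. if i = a then real (k + 1) * r a - (\<Sum>l<k. r l) else real (k+1))"
      by (subst det_nat_almost_diagonal[where a = a]) (auto intro!: prod.cong)
    also have "\<dots> = real (k + 1) ^ (k - 1) * (real (k + 1) * r a - (\<Sum>j<k. r j))"
    proof -
      have "prod g {..<k} = g a * prod g ({..<k} - {a})" for g :: "nat \<Rightarrow> real"
        using a by (intro prod.remove) auto
      moreover have "card ({..<k} - {a}) = k - 1" using a by simp
      ultimately show ?thesis by (simp add: mult.commute)
    qed
    finally show ?thesis .
  qed
  show ?thesis
  proof (cases "k = 0")
    case True then show ?thesis by (intro exI[of _ 1]) simp
  next
    case False
    \<comment> \<open>Taking the unit vector at 0 as row 0 makes the right side of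
      \<open>key\<close> equal to k (k+1)^(k-1), which is nonzero.\<close>
    have "det_nat k N \<noteq> 0"
    proof
      assume "det_nat k N = 0"
      with key[of 0 "\<lambda>j. if j = 0 then 1 else 0"] False show False by simp
    qed
    then show ?thesis
      using key by (intro exI[of _ "real (k+1)^(k-1) / det_nat k N"]) (simp add: field_simps)
  qed
qed

lemma det_nat_regular_gram_nonzero: "det_nat k regular_gram \<noteq> 0"
proof (cases "k = 0")
  case True then show ?thesis by (simp add: det_nat_def)
next
  case False
  obtain C where C: "C \<noteq> 0" "\<forall>a<k. \<forall>r. det_nat k (\<lambda>i. if i = a then r else regular_gram i)
      = C * (real (k + 1) * r a - (\<Sum>j<k. r j))"
    using det_nat_regular_gram_row by blast
  have "(\<Sum>j<k. regular_gram 0 j) = (\<Sum>j<k. (if j = 0 then 1 else 0) + 1)"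
    by (intro sum.cong) (auto simp: regular_gram_def)
  then have "(\<Sum>j<k. regular_gram 0 j) = real k + 1" using False by (simp add: sum.distrib)
  moreover have "(\<lambda>i. if i = 0 then regular_gram 0 else regular_gram i) = regular_gram" by auto
  ultimately have "det_nat k regular_gram = C * (real k + 1)"
    using C(2)[rule_format, of 0 "regular_gram 0"] False by (simp add: regular_gram_def)
  then show ?thesis using C(1) by simp
qed

text \<open>The real \<open>sqrt\<close> is extended to negative numbers as an odd function, so
  nonvanishing of a Gram determinant suffices for differentiating its root.\<close>

lemma sqrt_has_nonzero_derivative:
  assumes "x \<noteq> 0"
  shows "\<exists>K\<noteq>0. DERIV sqrt x :> K"
proof -
  define K where "K = (if x > 0 then inverse (sqrt x) / 2 else - inverse (sqrt x) / 2)"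
  have "DERIV sqrt x :> K"
    by (rule DERIV_real_sqrt_generic) (use assms in \<open>simp_all add: K_def\<close>)
  moreover have "K \<noteq> 0" using assms by (simp add: K_def)
  ultimately show ?thesis by blast
qed

text \<open>Jacobi's formula: the determinant is differentiated row by row, and
  \<open>det_nat_regular_gram_row\<close> evaluates each summand. The constant is chosen before
  \<open>G\<close> and \<open>x\<close>, so that one \<open>K\<close> serves all faces of the same
  dimension.\<close>

lemma sqrt_det_nat_has_derivative:
  "\<exists>K\<noteq>0. \<forall>(G :: 'a::real_normed_vector \<Rightarrow> nat \<Rightarrow> nat \<Rightarrow> real) G' x.
     (\<forall>i<k. \<forall>j<k. ((\<lambda>y. G y i j) has_derivative G' i j) (at x)) \<longrightarrow>
     (\<forall>i<k. \<forall>j<k. G x i j = regular_gram i j) \<longrightarrow>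
     ((\<lambda>y. sqrt (det_nat k (G y))) has_derivative
       (\<lambda>h. K * (real (k + 1) * (\<Sum>i<k. G' i i h) - (\<Sum>i<k. \<Sum>j<k. G' i j h)))) (at x)"
proof -
  obtain C where C: "C \<noteq> 0" "\<forall>a<k. \<forall>r. det_nat k (\<lambda>i. if i = a then r else regular_gram i)
      = C * (real (k + 1) * r a - (\<Sum>j<k. r j))"
    using det_nat_regular_gram_row by blast
  obtain K where K: "K \<noteq> 0" "DERIV sqrt (det_nat k regular_gram) :> K"
    using sqrt_has_nonzero_derivative[OF det_nat_regular_gram_nonzero[of k]] by blast
  have "((\<lambda>y. sqrt (det_nat k (G y))) has_derivative
       (\<lambda>h. K * C * (real (k + 1) * (\<Sum>i<k. G' i i h) - (\<Sum>i<k. \<Sum>j<k. G' i j h)))) (at x)"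
    if d: "\<forall>i<k. \<forall>j<k. ((\<lambda>y. G y i j) has_derivative G' i j) (at x)"
      and e: "\<forall>i<k. \<forall>j<k. G x i j = regular_gram i j"
    for G :: "'a \<Rightarrow> nat \<Rightarrow> nat \<Rightarrow> real" and G' x
  proof -
    have "((\<lambda>y. det_nat k (G y)) has_derivative
       (\<lambda>h. \<Sum>\<sigma> | \<sigma> permutes {..<k}. of_int (sign \<sigma>) *
          (\<Sum>i<k. G' i (\<sigma> i) h * (\<Prod>j\<in>{..<k} - {i}. G x j (\<sigma> j))))) (at x)"
      unfolding det_nat_def
    proof (intro has_derivative_sum has_derivative_mult_right has_derivative_prod)
      fix \<sigma> i assume "\<sigma> \<in> {\<sigma>. \<sigma> permutes {..<k}}" and i: "i \<in> {..<k}"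
      then have "\<sigma> i < k" using permutes_in_image[of \<sigma> "{..<k}" i] by simp
      then show "((\<lambda>y. G y i (\<sigma> i)) has_derivative G' i (\<sigma> i)) (at x)" using d i by blast
    qed
    also have "(\<lambda>h. \<Sum>\<sigma> | \<sigma> permutes {..<k}. of_int (sign \<sigma>) *
          (\<Sum>i<k. G' i (\<sigma> i) h * (\<Prod>j\<in>{..<k} - {i}. G x j (\<sigma> j))))
       = (\<lambda>h. \<Sum>i<k. det_nat k (\<lambda>j. if j = i then (\<lambda>l. G' i l h) else regular_gram j))"
    proof
      fix h
      \<comment> \<open>Each term of the product rule is a Leibniz term of the matrix with row
        \<open>i\<close> differentiated; exchanging the two sums then gives \<open>k\<close>
        determinants.\<close>
      have "G' i (\<sigma> i) h * (\<Prod>j\<in>{..<k} - {i}. G x j (\<sigma> j)) =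
          (\<Prod>j<k. (if j = i then (\<lambda>l. G' i l h) else regular_gram j) (\<sigma> j))"
        if "i < k" "\<sigma> permutes {..<k}" for i \<sigma>
      proof -
        have *: "\<sigma> j < k" if "j < k" for j
          using permutes_in_image[OF \<open>\<sigma> permutes {..<k}\<close>, of j] that by simp
        have "(\<Prod>j\<in>{..<k} - {i}. G x j (\<sigma> j)) =
            (\<Prod>j\<in>{..<k} - {i}. (if j = i then (\<lambda>l. G' i l h) else regular_gram j) (\<sigma> j))"
          using e * by (intro prod.cong) auto
        then show ?thesis using that by (subst (2) prod.remove[where x = i]) auto
      qed
      then have "(\<Sum>\<sigma> | \<sigma> permutes {..<k}. of_int (sign \<sigma>) *
          (\<Sum>i<k. G' i (\<sigma> i) h * (\<Prod>j\<in>{..<k} - {i}. G x j (\<sigma> j)))) =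
        (\<Sum>\<sigma> | \<sigma> permutes {..<k}. \<Sum>i<k. of_int (sign \<sigma>) *
          (\<Prod>j<k. (if j = i then (\<lambda>l. G' i l h) else regular_gram j) (\<sigma> j)))"
        by (simp add: sum_distrib_left)
      then show "(\<Sum>\<sigma> | \<sigma> permutes {..<k}. of_int (sign \<sigma>) *
          (\<Sum>i<k. G' i (\<sigma> i) h * (\<Prod>j\<in>{..<k} - {i}. G x j (\<sigma> j)))) =
        (\<Sum>i<k. det_nat k (\<lambda>j. if j = i then (\<lambda>l. G' i l h) else regular_gram j))"
        unfolding det_nat_def by (rule trans[OF _ sum.swap])
    qed
    also have "\<dots> = (\<lambda>h. C * (real (k + 1) * (\<Sum>i<k. G' i i h) - (\<Sum>i<k. \<Sum>j<k. G' i j h)))"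
      by (intro ext) (simp add: C(2) sum_distrib_left right_diff_distrib sum_subtractf mult_ac)
    finally have D: "((\<lambda>y. det_nat k (G y)) has_derivative
      (\<lambda>h. C * (real (k + 1) * (\<Sum>i<k. G' i i h) - (\<Sum>i<k. \<Sum>j<k. G' i j h)))) (at x)" .
    have "det_nat k (G x) = det_nat k regular_gram" using e by (intro det_nat_cong) auto
    with K(2) have "(sqrt has_derivative (*) K) (at (det_nat k (G x)))"
      by (simp add: has_field_derivative_def)
    from has_derivative_compose[OF D this] show ?thesis by (simp add: mult.assoc)
  qed
  with K(1) C(1) show ?thesis by (intro exI[of _ "K * C"]) auto
qed

subsection \<open>Face volumes\<close>

lemma face_volume_altdef:
  assumes "card S = Suc k"
  shows "face_volume p S = sqrt (det_nat k (\<lambda>a b.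
    (p (sorted_list_of_set S ! Suc a) - p (sorted_list_of_set S ! 0)) \<bullet>
    (p (sorted_list_of_set S ! Suc b) - p (sorted_list_of_set S ! 0)))) / fact k"
proof -
  have len: "length (sorted_list_of_set S) = Suc k" using assms by simp
  then have "hd (sorted_list_of_set S) = sorted_list_of_set S ! 0"
    by (metis hd_conv_nth list.size(3) nat.distinct(1))
  then show ?thesis
    unfolding face_volume_def Let_def length_map length_tl len
    using assms by simp (intro det_nat_cong, simp add: len nth_tl)
qed

lemma inner_diff_conv_dist:
  fixes x y z :: "'a::real_inner"
  shows "(x - z) \<bullet> (y - z) = ((dist x z)\<^sup>2 + (dist y z)\<^sup>2 - (dist x y)\<^sup>2) / 2"
  unfolding dist_norm power2_norm_eq_inner by (simp add: inner_diff inner_commute)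

text \<open>By polarization the Gram matrix is a function of the pairwise distances. This makes the
  volume independent of the simplex realizing given edge lengths.\<close>

lemma face_volume_cong_dist:
  assumes "card S = Suc k" "\<And>i j. i \<in> S \<Longrightarrow> j \<in> S \<Longrightarrow> dist (p i) (p j) = dist (q i) (q j)"
  shows "face_volume p S = face_volume q S"
proof -
  have "finite S" using assms(1) card.infinite by force
  then have S: "sorted_list_of_set S ! i \<in> S" if "i < Suc k" for i
    using nth_mem[of i "sorted_list_of_set S"] that assms(1) by simp
  have "det_nat k (\<lambda>a b.
    (p (sorted_list_of_set S ! Suc a) - p (sorted_list_of_set S ! 0)) \<bullet>
    (p (sorted_list_of_set S ! Suc b) - p (sorted_list_of_set S ! 0))) =
    det_nat k (\<lambda>a b.
    (q (sorted_list_of_set S ! Suc a) - q (sorted_list_of_set S ! 0)) \<bullet>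
    (q (sorted_list_of_set S ! Suc b) - q (sorted_list_of_set S ! 0)))"
    unfolding inner_diff_conv_dist by (intro det_nat_cong) (simp add: assms(2) S)
  then show ?thesis by (simp add: face_volume_altdef[OF assms(1)])
qed

text \<open>\<open>sqrt\<close> is continuous also at 0, so degenerate faces are covered. The open
  mapping theorem asks for continuity on an open set but for a derivative at one point only.\<close>

lemma continuous_on_face_volume:
  assumes "card S = Suc k" "\<And>i. i \<in> S \<Longrightarrow> continuous_on A (\<lambda>y. p y i)"
  shows "continuous_on A (\<lambda>y. face_volume (p y) S)"
proof -
  have "finite S" using assms(1) card.infinite by force
  then have S: "sorted_list_of_set S ! i \<in> S" if "i < Suc k" for i
    using nth_mem[of i "sorted_list_of_set S"] that assms(1) by simp
  have "sorted_list_of_set S ! Suc (\<sigma> i) \<in> S" if "\<sigma> permutes {..<k}" "i < k" for \<sigma> i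
    using S permutes_in_image[OF that(1), of i] that(2) by simp
  then show ?thesis
    unfolding face_volume_altdef[OF assms(1)] det_nat_def
    by (intro continuous_intros assms(2)) (auto intro: S)
qed

lemma sum_nth_sorted_list_of_set:
  fixes g :: "nat \<Rightarrow> 'b::comm_monoid_add"
  assumes "card S = Suc k"
  shows "sum g S = g (sorted_list_of_set S ! 0) + (\<Sum>a<k. g (sorted_list_of_set S ! Suc a))"
proof -
  have "finite S" using assms card.infinite by force
  then have "bij_betw (\<lambda>i. sorted_list_of_set S ! i) {..<Suc k} S"
    using assms by (intro bij_betw_nth) auto
  then have "sum g S = (\<Sum>i<Suc k. g (sorted_list_of_set S ! i))"
    by (rule sum.reindex_bij_betw[symmetric])
  then show ?thesis by (simp only: sum.lessThan_Suc_shift)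
qed

text \<open>In terms of edges, the trace expression of \<open>sqrt_det_nat_has_derivative\<close>
  collapses to a sum in which all edges of the face have equal weight, as the symmetry of the
  regular simplex suggests.\<close>

lemma face_volume_has_derivative:
  "\<exists>K\<noteq>0. \<forall>S (p :: 'a::real_normed_vector \<Rightarrow> nat \<Rightarrow> 'b::euclidean_space) p' x.
     card S = Suc k \<longrightarrow> (\<forall>i\<in>S. ((\<lambda>y. p y i) has_derivative p' i) (at x)) \<longrightarrow>
     (\<forall>i\<in>S. \<forall>j\<in>S. i \<noteq> j \<longrightarrow> (dist (p x i) (p x j))\<^sup>2 = 2) \<longrightarrow>
     ((\<lambda>y. face_volume (p y) S) has_derivative
       (\<lambda>h. K * (\<Sum>i\<in>S. \<Sum>j\<in>S. (p x i - p x j) \<bullet> (p' i h - p' j h)))) (at x)"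
proof -
  obtain K where K: "K \<noteq> 0" and deriv: "\<forall>(G :: 'a \<Rightarrow> nat \<Rightarrow> nat \<Rightarrow> real) G' x.
     (\<forall>i<k. \<forall>j<k. ((\<lambda>y. G y i j) has_derivative G' i j) (at x)) \<longrightarrow>
     (\<forall>i<k. \<forall>j<k. G x i j = regular_gram i j) \<longrightarrow>
     ((\<lambda>y. sqrt (det_nat k (G y))) has_derivative
       (\<lambda>h. K * (real (k + 1) * (\<Sum>i<k. G' i i h) - (\<Sum>i<k. \<Sum>j<k. G' i j h)))) (at x)"
    using sqrt_det_nat_has_derivative[where ?'a = 'a, of k] by (elim exE conjE) (rule that)
  have "((\<lambda>y. face_volume (p y) S) has_derivative
       (\<lambda>h. K / fact k * (\<Sum>i\<in>S. \<Sum>j\<in>S. (p x i - p x j) \<bullet> (p' i h - p' j h)))) (at x)"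
    if card: "card S = Suc k" and p': "\<forall>i\<in>S. ((\<lambda>y. p y i) has_derivative p' i) (at x)"
      and dist: "\<forall>i\<in>S. \<forall>j\<in>S. i \<noteq> j \<longrightarrow> (dist (p x i) (p x j))\<^sup>2 = 2"
    for S and p :: "'a \<Rightarrow> nat \<Rightarrow> 'b" and p' x
  proof -
    define s where "s i = sorted_list_of_set S ! i" for i
    have fin: "finite S" using card card.infinite by force
    have s: "s i \<in> S" if "i \<le> k" for i
      using nth_mem[of i "sorted_list_of_set S"] that card fin by (simp add: s_def)
    have s_inj: "s i = s j \<longleftrightarrow> i = j" if "i \<le> k" "j \<le> k" for i j
      using that card fin by (simp add: s_def nth_eq_iff_index_eq)
    define G where "G y a b = (p y (s (Suc a)) - p y (s 0)) \<bullet> (p y (s (Suc b)) - p y (s 0))" for y a b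
    define G' where "G' a b h = (p x (s (Suc a)) - p x (s 0)) \<bullet> (p' (s (Suc b)) h - p' (s 0) h) +
      (p' (s (Suc a)) h - p' (s 0) h) \<bullet> (p x (s (Suc b)) - p x (s 0))" for a b h
    \<comment> \<open>Half the derivative at \<open>x\<close> of the squared length of the edge
      \<open>i\<close>, \<open>j\<close>.\<close>
    define L where "L i j h = (p x i - p x j) \<bullet> (p' i h - p' j h)" for i j h
    have "((\<lambda>y. sqrt (det_nat k (G y))) has_derivative
       (\<lambda>h. K * (real (k + 1) * (\<Sum>i<k. G' i i h) - (\<Sum>i<k. \<Sum>j<k. G' i j h)))) (at x)"
    proof (rule deriv[rule_format])
      fix a b assume ab: "a < k" "b < k"
      have p's: "((\<lambda>y. p y (s i)) has_derivative p' (s i)) (at x)" if "i \<le> k" for i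
        using p' s[OF that] by blast
      show "((\<lambda>y. G y a b) has_derivative G' a b) (at x)"
        unfolding G_def G'_def using ab by (intro has_derivative_inner has_derivative_diff p's) auto
      have "(dist (p x (s i)) (p x (s j)))\<^sup>2 = (if i = j then 0 else 2)" if "i \<le> k" "j \<le> k" for i j
        using dist s[OF that(1)] s[OF that(2)] s_inj[OF that] by simp
      then show "G x a b = regular_gram a b"
        using ab by (simp add: G_def inner_diff_conv_dist regular_gram_def)
    qed
    moreover have "real (k + 1) * (\<Sum>i<k. G' i i h) - (\<Sum>i<k. \<Sum>j<k. G' i j h) =
       (\<Sum>i\<in>S. \<Sum>j\<in>S. L i j h)" for h
    proof -
      \<comment> \<open>\<open>A\<close> collects the edges at the base vertex, \<open>B\<close> the
        ordered pairs of other vertices. The trace is 2A and the full sum of \<open>G'\<close> is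
        2kA - B, so the left side is 2(k+1)A - 2kA + B = 2A + B.\<close>
      define A where "A = (\<Sum>a<k. L (s (Suc a)) (s 0) h)"
      define B where "B = (\<Sum>a<k. \<Sum>b<k. L (s (Suc a)) (s (Suc b)) h)"
      have G': "G' a b h = L (s (Suc a)) (s 0) h + L (s (Suc b)) (s 0) h
          - L (s (Suc a)) (s (Suc b)) h" for a b
        by (simp add: G'_def L_def inner_diff inner_commute)
      have L: "L i i h = 0" "L i j h = L j i h" for i j
        by (simp_all add: L_def inner_diff)
      have "(\<Sum>i<k. \<Sum>j<k. G' i j h) = 2 * real k * A - B"
        by (simp add: G' A_def B_def sum_subtractf sum.distrib sum_distrib_left[symmetric])
      moreover have "(\<Sum>i<k. G' i i h) = 2 * A"
        by (simp add: G' L A_def sum_distrib_left)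
      moreover have "(\<Sum>i\<in>S. \<Sum>j\<in>S. L i j h) = 2 * A + B"
        using L(2)[of "s 0"]
        by (simp add: sum_nth_sorted_list_of_set[OF card] s_def[symmetric] L(1) A_def B_def sum.distrib)
      ultimately show ?thesis by (simp add: algebra_simps)
    qed
    ultimately have "((\<lambda>y. sqrt (det_nat k (G y))) has_derivative
       (\<lambda>h. K * (\<Sum>i\<in>S. \<Sum>j\<in>S. L i j h))) (at x)" by simp
    from has_derivative_mult_right[OF this, of "1 / fact k"]
    have "((\<lambda>y. sqrt (det_nat k (G y)) / fact k) has_derivative
       (\<lambda>h. K / fact k * (\<Sum>i\<in>S. \<Sum>j\<in>S. L i j h))) (at x)" by simp
    moreover have "face_volume (p y) S = sqrt (det_nat k (G y)) / fact k" for y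
      unfolding face_volume_altdef[OF card] G_def s_def ..
    ultimately show ?thesis by (simp only: L_def)
  qed
  with K show ?thesis by (intro exI[of _ "K / fact k"]) simp
qed

subsection \<open>Inverting the Kneser graph\<close>

text \<open>On functions on pairs, the Kneser adjacency operator maps y to T - D i - D j + y, where T is
  the total of y and D i its sum over the pairs containing i. The coefficients below come from
  solving for x in the span of y, D i + D j and T. The double sum over ordered pairs is 2 T.\<close>
definition kneser_inverse :: "'a set \<Rightarrow> ('a \<Rightarrow> 'a \<Rightarrow> real) \<Rightarrow> 'a \<Rightarrow> 'a \<Rightarrow> real" where
  "kneser_inverse X Y i j = (if i = j then 0 else
     Y i j - ((\<Sum>k\<in>X. Y i k) + (\<Sum>k\<in>X. Y j k)) / (real (card X) - 3)
     + (\<Sum>k\<in>X. \<Sum>l\<in>X. Y k l) / ((real (card X) - 2) * (real (card X) - 3)))"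

text \<open>The factor 2 arises because the sum runs over ordered pairs disjoint from
  \<open>{a, b}\<close>. At least four vertices keep both denominators nonzero.\<close>

lemma sum_kneser_inverse:
  assumes X: "finite X" "card X \<ge> 4" and ab: "a \<in> X" "b \<in> X" "a \<noteq> b"
    and Y: "\<And>i j. Y i j = Y j i" "\<And>i. Y i i = 0"
  shows "(\<Sum>i\<in>X - {a, b}. \<Sum>j\<in>X - {a, b}. kneser_inverse X Y i j) = 2 * Y a b"
proof -
  define Z where "Z = X - {a, b}"
  define M where "M = real (card X) - 2"
  have M: "real (card Z) = M" "M \<ge> 2"
    using X ab by (auto simp: Z_def M_def card_Diff_subset)
  have finZ: "finite Z" using X by (simp add: Z_def)
  have split: "sum g X = g a + g b + sum g Z" for g :: "'a \<Rightarrow> real"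
  proof -
    have "X = insert a (insert b Z)" using ab by (auto simp: Z_def)
    then have "sum g X = sum g (insert a (insert b Z))" by simp
    also have "\<dots> = g a + g b + sum g Z" using ab finZ by (simp add: Z_def)
    finally show ?thesis .
  qed
  define D where "D i = (\<Sum>k\<in>X. Y i k)" for i
  define T where "T = (\<Sum>k\<in>X. D k)"
  define U where "U = (\<Sum>k\<in>Z. D k)"
  \<comment> \<open>The same formula without the exception on the diagonal, so that double sums
    factor; the diagonal is subtracted afterwards.\<close>
  define g where "g i j = Y i j - (D i + D j) / (M - 1) + T / (M * (M - 1))" for i j
  have "kneser_inverse X Y i j = g i j - (if i = j then g i i else 0)" for i j
    by (simp add: kneser_inverse_def g_def D_def T_def M_def Y(2))
  then have "(\<Sum>i\<in>Z. \<Sum>j\<in>Z. kneser_inverse X Y i j) = (\<Sum>i\<in>Z. \<Sum>j\<in>Z. g i j) - (\<Sum>i\<in>Z. g i i)"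
    using finZ by (simp add: sum_subtractf)
  also have "(\<Sum>i\<in>Z. g i i) = - (2 * U / (M - 1)) + M * (T / (M * (M - 1)))"
    by (simp add: g_def Y(2) sum.distrib sum_subtractf sum_negf M(1) U_def sum_divide_distrib sum_distrib_left)
  also have "(\<Sum>i\<in>Z. \<Sum>j\<in>Z. g i j) = (\<Sum>i\<in>Z. \<Sum>j\<in>Z. Y i j) - 2 * M * U / (M - 1) + M * M * (T / (M * (M - 1)))"
    by (simp add: g_def sum.distrib sum_subtractf M(1) U_def add_divide_distrib
        sum_divide_distrib[symmetric] sum_distrib_left[symmetric])
  also have "(\<Sum>i\<in>Z. \<Sum>j\<in>Z. Y i j) = U - (D a - Y a b) - (D b - Y a b)"
  proof -
    have "(\<Sum>j\<in>Z. Y i j) = D i - Y i a - Y i b" for i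
      using split[of "Y i"] by (simp add: D_def)
    moreover have "(\<Sum>i\<in>Z. Y i c) = D c - Y c a - Y c b" for c
      using split[of "Y c"] by (simp add: D_def Y(1)[of _ c])
    ultimately show ?thesis by (simp add: sum_subtractf U_def Y(2) Y(1)[of b a])
  qed
  also have "U = T - D a - D b" using split[of D] by (simp add: T_def U_def)
  also have "T - D a - D b - (D a - Y a b) - (D b - Y a b) - 2 * M * (T - D a - D b) / (M - 1) +
      M * M * (T / (M * (M - 1))) - (- (2 * (T - D a - D b) / (M - 1)) + M * (T / (M * (M - 1)))) = 2 * Y a b"
  proof -
    have "2 * M * (T - D a - D b) / (M - 1) = 2 * (T - D a - D b) + 2 * (T - D a - D b) / (M - 1)"
      using M(2) by (simp add: field_simps)
    moreover have "M * M * (T / (M * (M - 1))) = T + M * (T / (M * (M - 1)))"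
      using M(2) by (simp add: field_simps)
    ultimately show ?thesis by simp
  qed
  finally show ?thesis by (simp add: Z_def)
qed

subsection \<open>The regular simplex and its deformations\<close>

text \<open>These are the inner products of the standard basis of an (n+1)-dimensional space after
  projection orthogonal to the all-ones vector: a regular simplex centred at the origin with squared
  edge length 2.\<close>

lemma regular_simplex_exists:
  "\<exists>p :: nat \<Rightarrow> real ^ 'n. \<forall>i\<in>{1..CARD('n) + 1}. \<forall>k\<in>{1..CARD('n) + 1}.
     p i \<bullet> p k = (if i = k then 1 else 0) - 1 / real (CARD('n) + 1)"
proof -
  define n where "n = real CARD('n)"
  have n: "n > 0" by (simp add: n_def)
  obtain h where h: "bij_betw h {1..CARD('n)} (UNIV :: 'n set)"
    using ex_bij_betw_nat_finite_1[of "UNIV :: 'n set"] by auto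
  define u :: "real ^ 'n" where "u = (\<chi> _. 1)"
  \<comment> \<open>In n dimensions, the last vertex is put on the diagonal and the others are
    shifted basis vectors. \<open>c\<close> gives the last vertex squared norm n/(n+1), and
    \<open>a\<close> gives it inner product -1/(n+1) with the others.\<close>
  define c where "c = 1 / sqrt (n + 1)"
  define a where "a = - (1 + c) / n"
  have c2: "c * c = 1 / (n + 1)" using n by (simp add: c_def)
  have a1: "1 + n * a = - c" using n by (simp add: a_def)
  define p where "p i = (if i = CARD('n) + 1 then c *\<^sub>R u else axis (h i) 1 + a *\<^sub>R u)" for i
  have uu: "u \<bullet> u = n" by (simp add: u_def inner_vec_def n_def)
  have ua: "u \<bullet> axis j 1 = 1" "axis j 1 \<bullet> u = 1" for j
    by (simp_all add: inner_axis inner_axis' u_def)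
  have "p i \<bullet> p k = (if i = k then 1 else 0) - 1 / (n + 1)"
    if "i \<in> {1..CARD('n) + 1}" "k \<in> {1..CARD('n) + 1}" for i k
  proof -
    have "c * c * n = 1 - 1 / (n + 1)" using n by (simp add: c2 field_simps)
    moreover have "c * (1 + a * n) = - 1 / (n + 1)"
      using a1 c2 by (simp add: mult.commute)
    moreover have "2 * a + a * a * n = - 1 / (n + 1)"
    proof -
      have "n * (2 * a + a * a * n) = (1 + n * a) * (1 + n * a) - 1" by (simp add: algebra_simps)
      also have "\<dots> = n * (- 1 / (n + 1))" unfolding a1 using n by (simp add: c2 field_simps)
      finally show ?thesis using n by (metis mult_left_cancel less_irrefl)
    qed
    moreover have "axis (h i) (1::real) \<bullet> axis (h k) 1 = (if i = k then 1 else 0)"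
      if "i \<noteq> CARD('n) + 1" "k \<noteq> CARD('n) + 1"
    proof -
      have "i \<in> {1..CARD('n)}" "k \<in> {1..CARD('n)}"
        using that \<open>i \<in> _\<close> \<open>k \<in> _\<close> by auto
      then have "h i = h k \<longleftrightarrow> i = k"
        using bij_betw_imp_inj_on[OF h] by (simp add: inj_on_eq_iff)
      then show ?thesis by (simp add: inner_axis_axis)
    qed
    ultimately show ?thesis
      by (auto simp: p_def inner_add uu ua algebra_simps)
  qed
  then show ?thesis by (intro exI[of _ p]) (simp add: n_def add.commute)
qed

text \<open>Coefficients indexed by labels instead of points treat both halves of nondegeneracy at
  once: a coincidence \<open>p i = p j\<close> is a dependence with coefficients 1 and -1.\<close>

lemma nondegenerate_simplexI:
  fixes p :: "nat \<Rightarrow> real ^ 'n"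
  assumes "\<And>u. (\<Sum>i=1..CARD('n)+1. u i) = 0 \<Longrightarrow> (\<Sum>i=1..CARD('n)+1. u i *\<^sub>R p i) = 0 \<Longrightarrow>
    \<forall>i\<in>{1..CARD('n)+1}. u i = 0"
  shows "nondegenerate_simplex p"
proof -
  define X where "X = {1..CARD('n)+1}"
  have fin: "finite X" by (simp add: X_def)
  have indep: "u i = 0" if "sum u X = 0" "(\<Sum>i\<in>X. u i *\<^sub>R p i) = 0" "i \<in> X" for u i
    using assms[of u] that unfolding X_def by blast
  have inj: "inj_on p X"
  proof (rule inj_onI, rule ccontr)
    fix i j assume ij: "i \<in> X" "j \<in> X" "p i = p j" "i \<noteq> j"
    define u :: "nat \<Rightarrow> real" where "u k = (if k = i then 1 else 0) - (if k = j then 1 else 0)" for k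
    have "sum u X = 0" using ij fin by (simp add: u_def sum_subtractf)
    moreover have "(\<Sum>k\<in>X. u k *\<^sub>R p k) = (\<Sum>k\<in>X. (if k = i then p i else 0) - (if k = j then p j else 0))"
      by (intro sum.cong) (auto simp: u_def)
    then have "(\<Sum>k\<in>X. u k *\<^sub>R p k) = 0" using ij fin by (simp add: sum_subtractf)
    ultimately have "u i = 0" using ij(1) by (rule indep)
    then show False using ij(4) by (simp add: u_def)
  qed
  have "\<not> affine_dependent (p ` X)"
  proof
    assume "affine_dependent (p ` X)"
    then have "\<exists>U. sum U (p ` X) = 0 \<and> (\<exists>v\<in>p ` X. U v \<noteq> 0) \<and> (\<Sum>v\<in>p ` X. U v *\<^sub>R v) = 0"
      using affine_dependent_explicit_finite[OF finite_imageI[OF fin], of p] by simp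
    then obtain U where U: "sum U (p ` X) = 0" "\<exists>v\<in>p ` X. U v \<noteq> 0" "(\<Sum>v\<in>p ` X. U v *\<^sub>R v) = 0"
      by (elim exE conjE) (rule that)
    from U(2) obtain i where i: "i \<in> X" "U (p i) \<noteq> 0" by blast
    have "(U \<circ> p) i = 0"
    proof (rule indep[OF _ _ i(1)])
      show "sum (U \<circ> p) X = 0" using U(1) by (simp add: sum.reindex[OF inj])
      show "(\<Sum>i\<in>X. (U \<circ> p) i *\<^sub>R p i) = 0" using U(3) by (simp add: sum.reindex[OF inj])
    qed
    with i(2) show False by simp
  qed
  with inj show ?thesis by (simp add: nondegenerate_simplex_def X_def)
qed

text \<open>If the coefficients sum to 0, pairing the combination of the \<open>p i\<close> with
  \<open>p k\<close> returns \<open>u k\<close>. A dependence among the \<open>q i\<close> thus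
  bounds each coefficient by the perturbation, and summing over all N vertices makes the total of
  the absolute values smaller than itself.\<close>

lemma nondegenerate_simplex_near_regular:
  fixes p q :: "nat \<Rightarrow> real ^ 'n"
  assumes p: "\<forall>i\<in>{1..CARD('n) + 1}. \<forall>k\<in>{1..CARD('n) + 1}.
      p i \<bullet> p k = (if i = k then 1 else 0) - 1 / real (CARD('n) + 1)"
    and q: "\<forall>i\<in>{1..CARD('n) + 1}. norm (q i - p i) < 1 / real (CARD('n) + 1)"
  shows "nondegenerate_simplex q"
proof (rule nondegenerate_simplexI)
  define X where "X = {1..CARD('n)+1}"
  define N where "N = real (CARD('n) + 1)"
  have N: "N > 0" "real (card X) = N" and fin: "finite X" by (simp_all add: N_def X_def)
  fix u :: "nat \<Rightarrow> real"
  assume "(\<Sum>i=1..CARD('n)+1. u i) = 0" "(\<Sum>i=1..CARD('n)+1. u i *\<^sub>R q i) = 0"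
  then have u: "(\<Sum>i\<in>X. u i) = 0" "(\<Sum>i\<in>X. u i *\<^sub>R q i) = 0" by (simp_all add: X_def)
  have bound: "\<bar>u k\<bar> \<le> (\<Sum>i\<in>X. \<bar>u i\<bar> * norm (q i - p i))" if k: "k \<in> X" for k
  proof -
    have "norm (p k) ^ 2 \<le> 1" using p k N(1)
      by (simp add: X_def power2_norm_eq_inner)
    then have pk: "norm (p k) \<le> 1" using power2_le_imp_le[of "norm (p k)" 1] by simp
    have "(\<Sum>i\<in>X. u i *\<^sub>R p i) = - (\<Sum>i\<in>X. u i *\<^sub>R (q i - p i))"
      using u(2) by (simp add: scaleR_diff_right sum_subtractf)
    moreover have pki: "p k \<bullet> p i = (if i = k then 1 else 0) - 1 / N" if "i \<in> X" for i
      using p k that unfolding X_def N_def by (simp add: eq_commute)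
    have "p k \<bullet> (\<Sum>i\<in>X. u i *\<^sub>R p i) = (\<Sum>i\<in>X. (if i = k then u k else 0) - u i / N)"
      unfolding inner_sum_right by (intro sum.cong) (simp_all add: pki right_diff_distrib)
    then have "p k \<bullet> (\<Sum>i\<in>X. u i *\<^sub>R p i) = u k"
      using k fin u(1) by (simp add: sum_subtractf sum_divide_distrib[symmetric])
    ultimately have "\<bar>u k\<bar> = \<bar>p k \<bullet> (\<Sum>i\<in>X. u i *\<^sub>R (q i - p i))\<bar>" by simp
    also have "\<dots> \<le> norm (p k) * norm (\<Sum>i\<in>X. u i *\<^sub>R (q i - p i))"
      by (rule Cauchy_Schwarz_ineq2)
    also have "\<dots> \<le> 1 * norm (\<Sum>i\<in>X. u i *\<^sub>R (q i - p i))"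
      using pk by (intro mult_right_mono) auto
    also have "\<dots> \<le> (\<Sum>i\<in>X. norm (u i *\<^sub>R (q i - p i)))"
      unfolding mult_1 by (rule norm_sum)
    finally show ?thesis by simp
  qed
  show "\<forall>i\<in>{1..CARD('n)+1}. u i = 0"
  proof (rule ccontr)
    assume "\<not> ?thesis"
    then obtain i0 where i0: "i0 \<in> X" "u i0 \<noteq> 0" by (auto simp: X_def)
    have "(\<Sum>k\<in>X. \<bar>u k\<bar>) \<le> (\<Sum>k\<in>X. \<Sum>i\<in>X. \<bar>u i\<bar> * norm (q i - p i))"
      by (intro sum_mono bound)
    also have "\<dots> = (\<Sum>i\<in>X. \<bar>u i\<bar> * (N * norm (q i - p i)))"
      by (simp add: N(2) sum_distrib_left mult_ac)
    also have "\<dots> < (\<Sum>i\<in>X. \<bar>u i\<bar> * 1)"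
    proof (rule sum_strict_mono_ex1[OF fin])
      have *: "N * norm (q i - p i) < 1" if "i \<in> X" for i
        using q that N(1) by (simp add: X_def N_def field_simps)
      then show "\<forall>i\<in>X. \<bar>u i\<bar> * (N * norm (q i - p i)) \<le> \<bar>u i\<bar> * 1"
        by (intro ballI mult_left_mono) (auto intro: less_imp_le)
      have "\<bar>u i0\<bar> * (N * norm (q i0 - p i0)) < \<bar>u i0\<bar> * 1"
        using *[OF i0(1)] i0(2) by (intro mult_strict_left_mono) auto
      with i0(1) show "\<exists>i\<in>X. \<bar>u i\<bar> * (N * norm (q i - p i)) < \<bar>u i\<bar> * 1" by blast
    qed
    finally show False by simp
  qed
qed

text \<open>\<open>SOME\<close> may pick another simplex, but one with the same pairwise
  distances.\<close>

lemma face_vol_fun_edge_lengths: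
  fixes p :: "nat \<Rightarrow> real ^ 'n"
  assumes n: "CARD('n) \<ge> 2" and p: "nondegenerate_simplex p" and S: "S \<in> faces CARD('n)"
  shows "face_vol_fun TYPE('n) S (edge_lengths p) = face_volume p S"
proof -
  define q where "q = (SOME q :: nat \<Rightarrow> real ^ 'n. nondegenerate_simplex q \<and> edge_lengths q = edge_lengths p)"
  have q: "edge_lengths q = edge_lengths p"
    unfolding q_def by (rule someI2[of _ p]) (use p in auto)
  have less: "dist (q i) (q j) = dist (p i) (p j)"
    if "i \<in> {1..CARD('n) + 1}" "j \<in> {1..CARD('n) + 1}" "i < j" for i j
    using that fun_cong[OF q, of "(i, j)"] by (simp add: edge_lengths_def)
  have "dist (q i) (q j) = dist (p i) (p j)" if "i \<in> S" "j \<in> S" for i j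
  proof -
    have "i \<in> {1..CARD('n) + 1}" "j \<in> {1..CARD('n) + 1}" using S that by (auto simp: faces_def)
    then show ?thesis using less[of i j] less[of j i]
      by (cases i j rule: linorder_cases) (simp_all add: dist_commute)
  qed
  moreover have "card S = Suc (CARD('n) - 2)" using S n by (simp add: faces_def)
  ultimately have "face_volume q S = face_volume p S" by (intro face_volume_cong_dist) auto
  then show ?thesis by (simp add: face_vol_fun_def q_def)
qed

lemma faces_conv_Diff:
  assumes "S \<in> faces n" "n \<ge> 1"
  obtains a b where "a \<in> {1..n+1}" "b \<in> {1..n+1}" "a \<noteq> b" "S = {1..n+1} - {a, b}"
proof -
  have S: "S \<subseteq> {1..n+1}" "card S = n - 1" using assms by (auto simp: faces_def)
  then have "card ({1..n+1} - S) = 2" using assms(2) by (simp add: card_Diff_subset finite_subset[OF S(1)])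
  then obtain a b where ab: "{1..n+1} - S = {a, b}" "a \<noteq> b" by (auto simp: card_2_iff)
  then have "S = {1..n+1} - {a, b}" using S(1) by blast
  with ab show ?thesis by (intro that[of a b]) auto
qed

text \<open>The displacements of the vertices by these sums change the squared edge lengths to first order
  by prescribed amounts.\<close>
lemma inner_deformation:
  fixes p :: "nat \<Rightarrow> 'a::real_inner"
  assumes p: "\<And>i k. i \<in> X \<Longrightarrow> k \<in> X \<Longrightarrow> p i \<bullet> p k = (if i = k then 1 else 0) - c"
    and x: "\<And>i j. x i j = x j i" "\<And>i. x i i = 0" and "finite X" "i \<in> X" "j \<in> X"
  shows "(p i - p j) \<bullet> ((\<Sum>k\<in>X. x i k *\<^sub>R p k) - (\<Sum>k\<in>X. x j k *\<^sub>R p k)) = - 2 * x i j"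
proof -
  \<comment> \<open>The constant \<open>c\<close> cancels in the difference, so
    \<open>p i - p j\<close> just reads off two coefficients.\<close>
  have "(p i - p j) \<bullet> (\<Sum>k\<in>X. x m k *\<^sub>R p k) = x m i - x m j" for m
  proof -
    have "(p i - p j) \<bullet> (\<Sum>k\<in>X. x m k *\<^sub>R p k) =
        (\<Sum>k\<in>X. (if k = i then x m i else 0) - (if k = j then x m j else 0))"
      unfolding inner_sum_right
      by (intro sum.cong) (use assms(4-6) in \<open>auto simp: inner_diff_left p\<close>)
    then show ?thesis using assms by (simp add: sum_subtractf)
  qed
  then show ?thesis using x(1)[of j i] by (simp add: inner_diff_right x(2))
qed

section \<open>The open mapping argument at the regular simplex\<close>

lemma face_volumes_fill_box:
  assumes n: "CARD('n) \<ge> 3"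
  shows "\<exists>A. (\<forall>S\<in>faces CARD('n). infinite (A S)) \<and>
    (\<forall>z. (\<forall>S\<in>faces CARD('n). z S \<in> A S) \<longrightarrow>
      (\<exists>p :: nat \<Rightarrow> real ^ 'n. nondegenerate_simplex p \<and> (\<forall>S\<in>faces CARD('n). face_volume p S = z S)))"
proof -
  define X where "X = {1..CARD('n) + 1}"
  define N where "N = real (CARD('n) + 1)"
  define F where "F = faces CARD('n)"
  have X: "finite X" "card X \<ge> 4" using n by (simp_all add: X_def)
  obtain p :: "nat \<Rightarrow> real ^ 'n" where
    p: "\<And>i k. i \<in> X \<Longrightarrow> k \<in> X \<Longrightarrow> p i \<bullet> p k = (if i = k then 1 else 0) - 1 / N"
    unfolding X_def N_def using regular_simplex_exists[where ?'n = 'n] by blast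
  obtain K where K: "K \<noteq> 0" and deriv: "\<forall>S (q :: real ^ 'n option set \<Rightarrow> nat \<Rightarrow> real ^ 'n) q' x.
     card S = Suc (CARD('n) - 2) \<longrightarrow> (\<forall>i\<in>S. ((\<lambda>y. q y i) has_derivative q' i) (at x)) \<longrightarrow>
     (\<forall>i\<in>S. \<forall>j\<in>S. i \<noteq> j \<longrightarrow> (dist (q x i) (q x j))\<^sup>2 = 2) \<longrightarrow>
     ((\<lambda>y. face_volume (q y) S) has_derivative
       (\<lambda>h. K * (\<Sum>i\<in>S. \<Sum>j\<in>S. (q x i - q x j) \<bullet> (q' i h - q' j h)))) (at x)"
    using face_volume_has_derivative[where ?'a = "real ^ 'n option set" and ?'b = "real ^ 'n", of "CARD('n) - 2"]
    by (elim exE conjE) (rule that)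
  \<comment> \<open>The type \<open>'n option\<close> has n + 1 elements, so vertices can be
    labelled by it and faces by members of the finite type \<open>'n option set\<close>, which
    indexes the coordinates of a Euclidean space.\<close>
  obtain g :: "nat \<Rightarrow> 'n option" where g: "bij_betw g X UNIV"
    using finite_same_card_bij[of X "UNIV :: 'n option set"] X(1) by (auto simp: X_def)
  define idx where "idx S = g ` S" for S
  have "F \<subseteq> Pow X" by (auto simp: F_def X_def faces_def)
  then have idx: "inj_on idx F"
    unfolding idx_def using inj_on_image_Pow[OF bij_betw_imp_inj_on[OF g]] inj_on_subset by blast
  \<comment> \<open>The prescribed first-order change of the volume of the face complementary to
    \<open>i\<close> and \<open>j\<close>.\<close>
  define Y :: "real ^ 'n option set \<Rightarrow> nat \<Rightarrow> nat \<Rightarrow> real"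
    where "Y y i j = (if i = j then 0 else y $ idx (X - {i, j}))" for y i j
  define x where "x y i j = kneser_inverse X (Y y) i j / K" for y i j
  define q where "q y i = (\<Sum>k\<in>X. x y i k *\<^sub>R p k)" for y i
  \<comment> \<open>The factor -1/4 turns the -2 of \<open>inner_deformation\<close> into 1/2, which
    cancels the 2 of \<open>sum_kneser_inverse\<close>; the \<open>K\<close> of the derivative
    cancels against the one in \<open>x\<close>.\<close>
  define P where "P y i = p i - (1 / 4) *\<^sub>R q y i" for y i
  have Y: "Y y i j = Y y j i" "Y y i i = 0" for y i j by (simp_all add: Y_def insert_commute)
  have x: "x y i j = x y j i" "x y i i = 0" for y i j
    by (simp_all add: x_def kneser_inverse_def Y(1)[of y i j] add.commute)
  have "bounded_linear (\<lambda>y. Y y i j)" for i j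
    unfolding Y_def by (cases "i = j") (simp_all add: bounded_linear_vec_nth bounded_linear_zero)
  then have "bounded_linear (\<lambda>y. x y i j)" for i j
    unfolding x_def kneser_inverse_def divide_inverse
    by (cases "i = j") (simp_all, intro bounded_linear_intros)
  then have q_linear: "bounded_linear (\<lambda>y. q y i)" for i
    unfolding q_def by (intro bounded_linear_intros)
  have q0: "q 0 i = 0" for i using bounded_linear.linear[OF q_linear[of i]] by (rule linear_0)
  have P0: "P 0 i = p i" for i by (simp add: P_def q0)
  have P_deriv: "((\<lambda>y. P y i) has_derivative (\<lambda>y. - (1 / 4) *\<^sub>R q y i)) (at y)" for i y
    unfolding P_def
    by (auto intro!: derivative_eq_intros bounded_linear.has_derivative[OF q_linear])
  have P_cont: "isCont (\<lambda>y. P y i) y" for i y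
    by (rule has_derivative_continuous[OF P_deriv])
  have card_face: "card S = Suc (CARD('n) - 2)" if "S \<in> F" for S
    using that n by (simp add: F_def faces_def)
  have dist: "(dist (p i) (p j))\<^sup>2 = 2" if "i \<in> X" "j \<in> X" "i \<noteq> j" for i j
    unfolding dist_norm power2_norm_eq_inner using that by (simp add: inner_diff p)
  have vol_deriv: "((\<lambda>y. face_volume (P y) S) has_derivative (\<lambda>y. y $ idx S)) (at 0)" if S: "S \<in> F" for S
  proof -
    obtain a b where ab: "a \<in> X" "b \<in> X" "a \<noteq> b" "S = X - {a, b}"
      using faces_conv_Diff[of S "CARD('n)"] S n unfolding F_def X_def by auto
    have "((\<lambda>y. face_volume (P y) S) has_derivative
       (\<lambda>h. K * (\<Sum>i\<in>S. \<Sum>j\<in>S. (P 0 i - P 0 j) \<bullet> (- (1 / 4) *\<^sub>R q h i - - (1 / 4) *\<^sub>R q h j)))) (at 0)"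
      using deriv[rule_format, OF card_face[OF S], of P "\<lambda>i y. - (1 / 4) *\<^sub>R q y i" 0] P_deriv dist
      by (simp add: P0 ab(4))
    moreover have "K * (\<Sum>i\<in>S. \<Sum>j\<in>S. (P 0 i - P 0 j) \<bullet> (- (1 / 4) *\<^sub>R q h i - - (1 / 4) *\<^sub>R q h j))
        = h $ idx S" for h
    proof -
      have "(P 0 i - P 0 j) \<bullet> (- (1 / 4) *\<^sub>R q h i - - (1 / 4) *\<^sub>R q h j) = x h i j / 2"
        if "i \<in> S" "j \<in> S" for i j
      proof -
        have "(p i - p j) \<bullet> (q h i - q h j) = - 2 * x h i j"
          unfolding q_def using that ab(4) by (intro inner_deformation[OF p x X(1)]) auto
        moreover have "- (1 / 4) *\<^sub>R q h i - - (1 / 4) *\<^sub>R q h j = - (1 / 4) *\<^sub>R (q h i - q h j)"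
          by (simp add: algebra_simps)
        ultimately show ?thesis unfolding P0 by simp
      qed
      then have "(\<Sum>i\<in>S. \<Sum>j\<in>S. (P 0 i - P 0 j) \<bullet> (- (1 / 4) *\<^sub>R q h i - - (1 / 4) *\<^sub>R q h j))
        = (\<Sum>i\<in>S. \<Sum>j\<in>S. kneser_inverse X (Y h) i j) / (2 * K)"
        by (simp add: x_def sum_divide_distrib mult.commute)
      also have "\<dots> = Y h a b / K"
        unfolding ab(4) by (subst sum_kneser_inverse[OF X ab(1-3) Y]) simp
      finally show ?thesis using K ab(3,4) by (simp add: Y_def)
    qed
    ultimately show ?thesis by simp
  qed
  \<comment> \<open>Coordinates that do not index a face are left unchanged, so that f has derivative id.\<close>
  define f :: "real ^ 'n option set \<Rightarrow> real ^ 'n option set" where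
    "f y = (\<chi> T. if T \<in> idx ` F then face_volume (P y) (the_inv_into F idx T) else y $ T)" for y
  have f_deriv: "(f has_derivative id) (at 0)"
  proof (subst has_derivative_componentwise_within, intro ballI)
    fix b :: "real ^ 'n option set" assume "b \<in> Basis"
    then obtain T where b: "b = axis T 1" by (auto simp: Basis_vec_def)
    have "((\<lambda>y. f y $ T) has_derivative (\<lambda>y. y $ T)) (at 0)"
    proof (cases "T \<in> idx ` F")
      case True
      then obtain S where S: "S \<in> F" "T = idx S" by auto
      with vol_deriv[OF S(1)] show ?thesis by (simp add: f_def the_inv_into_f_f[OF idx])
    next
      case False
      then show ?thesis
        by (simp add: f_def bounded_linear.has_derivative[OF bounded_linear_vec_nth has_derivative_ident])
    qed
    then show "((\<lambda>y. f y \<bullet> b) has_derivative (\<lambda>y. id y \<bullet> b)) (at 0)"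
      by (simp add: b inner_axis)
  qed
  have f_cont: "continuous_on UNIV f"
    unfolding f_def
  proof (rule continuous_on_vec_lambda)
    fix T
    have "continuous_on UNIV (\<lambda>y. P y i)" for i
      using P_cont by (simp add: continuous_on_eq_continuous_at)
    then have "continuous_on UNIV (\<lambda>y. face_volume (P y) (the_inv_into F idx T))" if "T \<in> idx ` F"
      using that card_face[OF the_inv_into_into[OF idx, of T F]]
      by (intro continuous_on_face_volume) auto
    then show "continuous_on UNIV (\<lambda>y. if T \<in> idx ` F then face_volume (P y) (the_inv_into F idx T) else y $ T)"
      by (cases "T \<in> idx ` F") (auto intro: continuous_intros)
  qed
  have "\<forall>\<^sub>F y in nhds 0. norm (P y i - p i) < 1 / N" for i
  proof -
    have "((\<lambda>y. P y i) \<longlongrightarrow> P 0 i) (nhds 0)"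
      using iffD1[OF tendsto_at_iff_tendsto_nhds[where g = "\<lambda>y. P y i"], OF P_cont[unfolded isCont_def]] .
    from tendstoD[OF this, of "1 / N"] show ?thesis by (simp add: dist_norm N_def P0)
  qed
  then have "\<forall>\<^sub>F y in nhds 0. \<forall>i\<in>X. norm (P y i - p i) < 1 / N"
    using X(1) by (intro eventually_ball_finite) auto
  then obtain U where U: "open U" "0 \<in> U" and nondeg: "\<And>y. y \<in> U \<Longrightarrow> nondegenerate_simplex (P y)"
    unfolding eventually_nhds X_def N_def
    using nondegenerate_simplex_near_regular[of p] p by (auto simp: X_def N_def)
  \<comment> \<open>The derivative at 0 is the identity, which is its own right inverse.\<close>
  have "f 0 \<in> interior (f ` U)"
    by (rule sussmann_open_mapping[OF open_UNIV f_cont _ f_deriv bounded_linear_ident])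
      (use U in \<open>auto simp: id_def interior_open\<close>)
  then obtain W where W: "open W" "f 0 \<in> W" "W \<subseteq> f ` U" by (auto simp: interior_def)
  then obtain B where B: "\<And>T. open (B T)" "\<And>T. f 0 $ T \<in> B T"
    "\<And>y. (\<forall>T. y $ T \<in> B T) \<Longrightarrow> y \<in> W"
    unfolding open_vec_def by metis
  show ?thesis
  proof (intro exI[of _ "\<lambda>S. B (idx S)"] conjI ballI allI impI)
    \<comment> \<open>A finite open set of reals would be clopen, hence empty or the whole
      line.\<close>
    fix S show "infinite (B (idx S))"
      using B(1,2)[of "idx S"] clopen[of "B (idx S)"] finite_imp_closed[of "B (idx S)"]
        infinite_UNIV_char_0[where ?'a = real] by force
  next
    fix z assume z: "\<forall>S\<in>faces CARD('n). z S \<in> B (idx S)"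
    \<comment> \<open>Coordinates that index no face take their value from \<open>f 0\<close>, which
      lies in the box.\<close>
    define w :: "real ^ 'n option set" where
      "w = (\<chi> T. if T \<in> idx ` F then z (the_inv_into F idx T) else f 0 $ T)"
    have "w \<in> W"
    proof (rule B(3), rule allI)
      fix T show "w $ T \<in> B T"
        using z B(2)[of T] by (auto simp: w_def F_def[symmetric] the_inv_into_f_f[OF idx])
    qed
    then obtain y where y: "y \<in> U" "f y = w" using W(3) by auto
    have "face_volume (P y) S = z S" if "S \<in> faces CARD('n)" for S
      using arg_cong[OF y(2), of "\<lambda>v. v $ idx S"] that
      by (simp add: f_def w_def F_def[symmetric] the_inv_into_f_f[OF idx])
    with nondeg[OF y(1)]
    show "\<exists>p :: nat \<Rightarrow> real ^ 'n. nondegenerate_simplex p \<and> (\<forall>S\<in>faces CARD('n). face_volume p S = z S)"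
      by blast
  qed
qed

subsection \<open>Algebraic independence\<close>

theorem theorem1:
  fixes c :: "(nat set \<Rightarrow> nat) \<Rightarrow> complex" and E :: "(nat set \<Rightarrow> nat) set"
  assumes "CARD('n::finite) \<ge> 3"
    and "finite E"
    and "\<forall>e\<in>E. \<forall>S. S \<notin> faces CARD('n) \<longrightarrow> e S = 0"
    and "\<exists>e\<in>E. c e \<noteq> 0"
  shows "\<not> (\<forall>l\<in>realizable_lengths TYPE('n).
            (\<Sum>e\<in>E. c e * (\<Prod>S\<in>faces CARD('n).
                 complex_of_real (face_vol_fun TYPE('n) S l) ^ e S)) = 0)"
proof
  assume zero: "\<forall>l\<in>realizable_lengths TYPE('n).
            (\<Sum>e\<in>E. c e * (\<Prod>S\<in>faces CARD('n).
                 complex_of_real (face_vol_fun TYPE('n) S l) ^ e S)) = 0"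
  obtain A where A: "\<forall>S\<in>faces CARD('n). infinite (A S)"
    "\<forall>z. (\<forall>S\<in>faces CARD('n). z S \<in> A S) \<longrightarrow>
      (\<exists>p :: nat \<Rightarrow> real ^ 'n. nondegenerate_simplex p \<and> (\<forall>S\<in>faces CARD('n). face_volume p S = z S))"
    using face_volumes_fill_box[OF assms(1)] by (elim exE conjE) (rule that)
  have "\<forall>e\<in>E. c e = 0"
  proof (rule multipoly_zero)
    show "finite (faces CARD('n))" by (simp add: faces_def)
    \<comment> \<open>Exponents vanish off the faces, so distinct members of \<open>E\<close> are
      distinct monomials.\<close>
    show "e = e'" if "e \<in> E" "e' \<in> E" "\<forall>S\<in>faces CARD('n). e S = e' S" for e e'
    proof
      fix S show "e S = e' S"
        using that(3) assms(3)[rule_format, OF that(1), of S] assms(3)[rule_format, OF that(2), of S]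
        by (cases "S \<in> faces CARD('n)") simp_all
    qed
    fix z assume "\<And>S. S \<in> faces CARD('n) \<Longrightarrow> z S \<in> A S"
    then have "\<forall>S\<in>faces CARD('n). z S \<in> A S" by simp
    from mp[OF spec[OF A(2), of z] this] obtain p :: "nat \<Rightarrow> real ^ 'n"
      where p: "nondegenerate_simplex p" "\<forall>S\<in>faces CARD('n). face_volume p S = z S"
      by (elim exE conjE) (rule that)
    have real: "edge_lengths p \<in> realizable_lengths TYPE('n)"
      using p(1) by (auto simp: realizable_lengths_def)
    have "face_vol_fun TYPE('n) S (edge_lengths p) = z S" if "S \<in> faces CARD('n)" for S
      using face_vol_fun_edge_lengths[OF _ p(1) that] p(2) that assms(1) by simp
    then have "(\<Sum>e\<in>E. c e * (\<Prod>S\<in>faces CARD('n). complex_of_real (z S) ^ e S)) =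
        (\<Sum>e\<in>E. c e * (\<Prod>S\<in>faces CARD('n).
          complex_of_real (face_vol_fun TYPE('n) S (edge_lengths p)) ^ e S))" by simp
    with bspec[OF zero real] show "(\<Sum>e\<in>E. c e * (\<Prod>S\<in>faces CARD('n). complex_of_real (z S) ^ e S)) = 0" by simp
  qed (use assms(2) A(1) in auto)
  with assms(4) show False by blast
qed

end
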